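(* Let $l\in\mathbb{N}$ and let $k_1<k_2$ be arbitrary real numbers. If $E$ is a syndetic subset of $\mathbb{Q}^l$, then $E$ is a RVDW$(l,k_1,k_2)$-set.
   Context: Notation: $\mathbb{N}=\{1,2,\ldots\}$, $\mathbb{Z}^\ast=\mathbb{Z}\setminus\{0\}$; for $\alpha\in\mathbb{Q}^l$, $c\in\mathbb{Q}$ and $F\subseteq\mathbb{Q}^l$, $\alpha+cF=\{\alpha+cf: f\in F\}$. Expansion of rationals: every rational number $q$ has a unique expression $q=\sum_{s=1}^{\infty}q_{-s}\frac{(-1)^{s}}{(s+1)!}+\sum_{r=1}^{\infty}q_{r}(-1)^{r+1}r!$ with integers $0\leq q_{-s}\leq s$ for $s\geq 1$ and $0\leq q_r\leq r$ for $r\geq 1$, all but finitely many of which are zero. Put $dom(q)=\{t\in\mathbb{Z}^\ast: q_t\neq 0\}$, $dom^-(q)=\{t\in dom(q): t<0\}$, $dom^+(q)=\{t\in dom(q): t>0\}$. Syndetic: a subset $E$ of an abelian (semi)group $(G,+)$ is syndetic if there is a non-empty finite $F\subseteq G$ with $G=\bigcup_{g\in F}\{s\in G: g+s\in E\}$; here $G=\mathbb{Q}^l$ under addition. RVDW set: $B\subseteq\mathbb{Q}^l$ is a RVDW$(l,k_1,k_2)$-set if for every non-empty finite $F\subseteq\mathbb{Q}^l$ and every $k\in\mathbb{N}$ there exist $\alpha\in\mathbb{Q}^l$, $\beta\in\mathbb{Q}\setminus\mathbb{Z}$ and $\gamma\in\mathbb{Z}^\ast$ with $dom^+(\beta)=\emptyset=dom^-(\gamma)$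 and $\max dom^-(\beta)<k_1<k_2<\min dom^+(\gamma)$ such that $\alpha+(p\beta+q\gamma)F\subseteq B$ for all integers $0\leq p,q\leq k$. *)

theory Defs
  imports "HOL-Analysis.Analysis"
begin

(* d t is the coefficient q_t; the bound at t = 0 forces d 0 = 0, so that a digit function on all
   of int carries the same data as one on the nonzero integers. The sums range over the
   finitely many nonzero digits. *)
definition is_expansion :: "rat \<Rightarrow> (int \<Rightarrow> int) \<Rightarrow> bool" where
  "is_expansion q d \<longleftrightarrow>
     finite {t. d t \<noteq> 0} \<and>
     (\<forall>t. 0 \<le> d t \<and> d t \<le> \<bar>t\<bar>) \<and>
     q = (\<Sum>s | 1 \<le> s \<and> d (- int s) \<noteq> 0. of_int (d (- int s)) * ((-1) ^ s / fact (s + 1)))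
       + (\<Sum>r | 1 \<le> r \<and> d (int r) \<noteq> 0. of_int (d (int r)) * ((-1) ^ (r + 1) * fact r))"

lemma radix_expansion_exists:
  fixes m :: "nat \<Rightarrow> int"
  assumes "\<And>i. m i \<ge> 2"
  shows "\<exists>a N. (\<forall>i. 0 \<le> a i \<and> a i < m i) \<and> (\<forall>i\<ge>N. a i = 0)
           \<and> x = (\<Sum>i<N. a i * (\<Prod>j<i. - m j))"
  using assms
proof (induction "2 * nat \<bar>x\<bar> + (if x < 0 then 1 else 0)" arbitrary: x m rule: less_induct)
  case less
  show ?case
  proof (cases "x = 0")
    case True
    have "m i > 0" for i using less.prems[of i] by linarith
    then show ?thesis using True by (intro exI[of _ "\<lambda>_. 0"] exI[of _ 0]) auto
  next
    case False
    define y where "y = - (x div m 0)"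
    have m0: "m 0 \<ge> 2" by (rule less.prems)
    have x: "x = x mod m 0 - m 0 * y" by (simp add: y_def)
    have r: "0 \<le> x mod m 0" "x mod m 0 < m 0" using m0 by auto
    have "2 * nat \<bar>y\<bar> + (if y < 0 then 1 else 0) < 2 * nat \<bar>x\<bar> + (if x < 0 then 1 else 0)"
    proof (cases "x > 0")
      case True
      have "0 \<le> x div m 0" "x div m 0 < x"
        using True m0 by (auto simp: pos_imp_zdiv_nonneg_iff int_div_less_self)
      then show ?thesis using True by (auto simp: y_def)
    next
      case F: False
      then have "x < 0" using False by simp
      have "x div m 0 < 0" using \<open>x < 0\<close> m0 by (simp add: neg_imp_zdiv_neg_iff div_neg_pos_less0)
      moreover have "x div m 0 \<ge> x"
      proof -
        have "m 0 * x \<le> x" using \<open>x < 0\<close> m0 by (simp add: mult_le_cancel_right1)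
        then have "(m 0 * x) div m 0 \<le> x div m 0" using m0 by (intro zdiv_mono1) auto
        then show ?thesis using m0 by simp
      qed
      ultimately show ?thesis using \<open>x < 0\<close> by (auto simp: y_def)
    qed
    from less.hyps[OF this, of "m \<circ> Suc"] less.prems
    obtain a N where a: "\<forall>i. 0 \<le> a i \<and> a i < m (Suc i)" "\<forall>i\<ge>N. a i = 0"
      "y = (\<Sum>i<N. a i * (\<Prod>j<i. - m (Suc j)))" by auto
    let ?b = "case_nat (x mod m 0) a"
    have "(\<Sum>i<Suc N. ?b i * (\<Prod>j<i. - m j)) = x mod m 0 - m 0 * y"
      unfolding sum.lessThan_Suc_shift prod.lessThan_Suc_shift a(3)
      by (simp add: sum_distrib_left mult_ac sum_negf)
    with x have "x = (\<Sum>i<Suc N. ?b i * (\<Prod>j<i. - m j))" by simp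
    moreover have "\<forall>i. 0 \<le> ?b i \<and> ?b i < m i" using r a by (auto split: nat.split)
    moreover have "\<forall>i\<ge>Suc N. ?b i = 0" using a by (auto split: nat.split)
    ultimately show ?thesis by blast
  qed
qed

lemma radix_expansion_unique:
  fixes m a b :: "nat \<Rightarrow> int"
  assumes "\<And>i. 0 \<le> a i \<and> a i < m i" "\<And>i. 0 \<le> b i \<and> b i < m i"
    and "(\<Sum>i<N. a i * (\<Prod>j<i. - m j)) = (\<Sum>i<N. b i * (\<Prod>j<i. - m j))" and "i < N"
  shows "a i = b i"
  using assms
proof (induction N arbitrary: a b m i)
  case (Suc N)
  have s: "(\<Sum>i<Suc N. c i * (\<Prod>j<i. - m j))
      = c 0 - m 0 * (\<Sum>i<N. c (Suc i) * (\<Prod>j<i. - m (Suc j)))" for c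
    unfolding sum.lessThan_Suc_shift prod.lessThan_Suc_shift
    by (simp add: sum_distrib_left mult_ac sum_negf)
  have e: "a 0 - m 0 * (\<Sum>i<N. a (Suc i) * (\<Prod>j<i. - m (Suc j)))
      = b 0 - m 0 * (\<Sum>i<N. b (Suc i) * (\<Prod>j<i. - m (Suc j)))"
    using Suc.prems(3) unfolding s .
  have "a 0 mod m 0 = b 0 mod m 0"
  proof -
    have "a 0 - b 0 = m 0 * ((\<Sum>i<N. a (Suc i) * (\<Prod>j<i. - m (Suc j)))
        - (\<Sum>i<N. b (Suc i) * (\<Prod>j<i. - m (Suc j))))"
      using e by (simp add: algebra_simps)
    then show ?thesis by (simp add: mod_eq_dvd_iff)
  qed
  then have ab0: "a 0 = b 0"
    using Suc.prems(1)[of 0] Suc.prems(2)[of 0] by simp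
  have "m 0 > 0" using Suc.prems(1)[of 0] by linarith
  with e ab0 have e': "(\<Sum>i<N. a (Suc i) * (\<Prod>j<i. - m (Suc j)))
      = (\<Sum>i<N. b (Suc i) * (\<Prod>j<i. - m (Suc j)))" by simp
  show ?case
  proof (cases i)
    case 0 then show ?thesis using ab0 by simp
  next
    case (Suc k)
    then show ?thesis
      using Suc.IH[of "\<lambda>i. a (Suc i)" "\<lambda>i. m (Suc i)" "\<lambda>i. b (Suc i)" k] Suc.prems e' by auto
  qed
qed simp

(* The positions -n, ..., -1, 1, ..., n in increasing order; going from one position t to the next
   multiplies the weight by - (|t| + 1), so that the expansion is a mixed radix expansion
   with negative bases. *)
definition radix_pos :: "nat \<Rightarrow> nat \<Rightarrow> int" where
  "radix_pos n i = (if i < n then int i - int n else int i - int n + 1)"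

definition radix_weight :: "int \<Rightarrow> rat" where
  "radix_weight t = (if t < 0 then (-1) ^ nat (-t) / fact (nat (-t) + 1) else (-1) ^ (nat t + 1) * fact (nat t))"

lemma radix_weight_pos: "fact (n + 1) * (-1) ^ n * radix_weight (radix_pos n i) = of_int (\<Prod>j<i. - (\<bar>radix_pos n j\<bar> + 1))"
proof (induction i)
  case 0
  show ?case by (cases "n = 0") (auto simp: radix_pos_def radix_weight_def  simp flip: power_add)
next
  case (Suc i)
  have "radix_weight (radix_pos n (Suc i)) = radix_weight (radix_pos n i) * of_int (- (\<bar>radix_pos n i\<bar> + 1))"
  proof -
    consider "Suc i < n" | "Suc i = n" | "i \<ge> n" by linarith
    then show ?thesis
    proof cases
      case 1
      then obtain k where k: "n = Suc (Suc (i + k))" by (metis less_imp_Suc_add add_Suc)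
      have e: "radix_pos n (Suc i) = - int (Suc k)" "radix_pos n i = - int (Suc (Suc k))"
        by (auto simp: radix_pos_def k)
      have w: "radix_weight (- int (Suc j)) = (-1) ^ Suc j / fact (Suc (Suc j))" for j
        by (simp add: radix_weight_def nat_add_distrib del: fact_Suc)
      have "(fact (Suc (Suc (Suc k))) :: rat) = of_nat (Suc (Suc (Suc k))) * fact (Suc (Suc k))"
        by (rule fact_Suc)
      then show ?thesis unfolding e w by (simp add: divide_simps del: fact_Suc) (simp add: algebra_simps)
    next
      case 2
      then show ?thesis by (auto simp: radix_pos_def radix_weight_def)
    next
      case 3
      then obtain k where k: "i = n + k" by (metis le_Suc_ex)
      show ?thesis by (simp add: radix_pos_def radix_weight_def k nat_add_distrib algebra_simps)
    qed
  qed
  then have "fact (n + 1) * (-1) ^ n * radix_weight (radix_pos n (Suc i))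
      = (fact (n + 1) * (-1) ^ n * radix_weight (radix_pos n i)) * of_int (- (\<bar>radix_pos n i\<bar> + 1))"
    by (simp only: mult.assoc)
  then show ?case unfolding Suc by (simp only: prod.lessThan_Suc of_int_mult)
qed

lemma digit_sums:
  assumes "\<And>t. \<bar>t\<bar> > int n \<Longrightarrow> d t = 0"
  shows "(\<Sum>s | 1 \<le> s \<and> d (- int s) \<noteq> 0. of_int (d (- int s)) * ((-1) ^ s / fact (s + 1)))
       + (\<Sum>r | 1 \<le> r \<and> d (int r) \<noteq> 0. of_int (d (int r)) * ((-1) ^ (r + 1) * fact r))
       = (\<Sum>i<2*n. of_int (d (radix_pos n i)) * radix_weight (radix_pos n i))"
proof -
  have n: "s \<le> n" if "d (int s) \<noteq> 0 \<or> d (- int s) \<noteq> 0" for s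
    using assms[of "int s"] assms[of "- int s"] that by force
  have "(\<Sum>s | 1 \<le> s \<and> d (- int s) \<noteq> 0. of_int (d (- int s)) * ((-1) ^ s / fact (s + 1)))
      = (\<Sum>s\<in>{1..n}. of_int (d (- int s)) * ((-1) ^ s / fact (s + 1) :: rat))"
    using n by (intro sum.mono_neutral_left) auto
  also have "\<dots> = (\<Sum>i<n. of_int (d (radix_pos n i)) * radix_weight (radix_pos n i))"
    by (rule sum.reindex_bij_witness[of _ "\<lambda>i. n - i" "\<lambda>s. n - s"])
       (auto simp: radix_pos_def radix_weight_def of_nat_diff nat_diff_distrib)
  finally have 1: "(\<Sum>s | 1 \<le> s \<and> d (- int s) \<noteq> 0. of_int (d (- int s)) * ((-1) ^ s / fact (s + 1)))
      = (\<Sum>i<n. of_int (d (radix_pos n i)) * radix_weight (radix_pos n i))" .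
  have "(\<Sum>r | 1 \<le> r \<and> d (int r) \<noteq> 0. of_int (d (int r)) * ((-1) ^ (r + 1) * fact r))
      = (\<Sum>r\<in>{1..n}. of_int (d (int r)) * ((-1) ^ (r + 1) * fact r :: rat))"
    using n by (intro sum.mono_neutral_left) auto
  also have "\<dots> = (\<Sum>i\<in>{n..<2*n}. of_int (d (radix_pos n i)) * radix_weight (radix_pos n i))"
    by (rule sum.reindex_bij_witness[of _ "\<lambda>i. i - n + 1" "\<lambda>s. s + n - 1"])
       (auto simp: radix_pos_def radix_weight_def of_nat_diff)
  finally have 2: "(\<Sum>r | 1 \<le> r \<and> d (int r) \<noteq> 0. of_int (d (int r)) * ((-1) ^ (r + 1) * fact r))
      = (\<Sum>i\<in>{n..<2*n}. of_int (d (radix_pos n i)) * radix_weight (radix_pos n i))" .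
  have "{..<2*n} = {..<n} \<union> {n..<2*n}" by auto
  then show ?thesis unfolding 1 2 by (simp add: sum.union_disjoint ivl_disj_int)
qed

lemma is_expansion_iff:
  assumes "\<And>t. \<bar>t\<bar> > int n \<Longrightarrow> d t = 0"
  shows "is_expansion q d \<longleftrightarrow> (\<forall>t. 0 \<le> d t \<and> d t \<le> \<bar>t\<bar>) \<and>
     fact (n + 1) * (-1) ^ n * q
       = of_int (\<Sum>i<2*n. d (radix_pos n i) * (\<Prod>j<i. - (\<bar>radix_pos n j\<bar> + 1)))"
proof -
  have "{t. d t \<noteq> 0} \<subseteq> {- int n..int n}" using assms by force
  then have fin: "finite {t. d t \<noteq> 0}" by (rule finite_subset) simp
  have nz: "fact (n + 1) * (-1) ^ n \<noteq> (0::rat)" by simp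
  let ?S = "\<Sum>i<2*n. of_int (d (radix_pos n i)) * radix_weight (radix_pos n i)"
  have "fact (n + 1) * (-1) ^ n * ?S
      = of_int (\<Sum>i<2*n. d (radix_pos n i) * (\<Prod>j<i. - (\<bar>radix_pos n j\<bar> + 1)))"
    unfolding sum_distrib_left of_int_sum of_int_mult
    by (intro sum.cong refl) (simp only: radix_weight_pos[symmetric] mult_ac)
  moreover have "q = ?S \<longleftrightarrow> fact (n + 1) * (-1) ^ n * q = fact (n + 1) * (-1) ^ n * ?S"
    using nz by (simp only: mult_cancel_left simp_thms)
  ultimately show ?thesis
    unfolding is_expansion_def using fin assms
    by (subst digit_sums[of n d]) (blast, simp only: simp_thms)
qed

lemma is_expansion_ex1: "\<exists>!d. is_expansion q d"
proof -
  have "\<exists>d. is_expansion q d"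
  proof -
    obtain a b where ab: "quotient_of q = (a, b)" by force
    have b: "b > 0" "q = of_int a / of_int b"
      using ab quotient_of_denom_pos quotient_of_div by auto
    define n0 where "n0 = nat b"
    have "n0 dvd fact (n0 + 1)" using b by (intro dvd_fact) (auto simp: n0_def)
    then obtain c :: nat where c: "fact (n0 + 1) = n0 * c" by (elim dvdE)
    have "(fact (n0 + 1) :: rat) = of_nat (fact (n0 + 1))" by (simp only: of_nat_fact)
    then have c': "(fact (n0 + 1) :: rat) = of_int b * of_nat c"
      unfolding c using b by (simp add: n0_def)
    define x where "x = int c * a * (-1) ^ n0"
    have qx: "fact (n0 + 1) * (-1) ^ n0 * q = of_int x"
      unfolding c' x_def b(2) using b(1) by simp
    define m where "m i = \<bar>radix_pos n0 i\<bar> + 1" for i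
    have "m i \<ge> 2" for i by (auto simp: m_def radix_pos_def)
    from radix_expansion_exists[of m x, OF this]
    obtain a N where a: "\<forall>i. 0 \<le> a i \<and> a i < m i" "\<forall>i\<ge>N. a i = 0"
      "x = (\<Sum>i<N. a i * (\<Prod>j<i. - m j))" by auto
    define d where "d t = (if t = 0 \<or> t < - int n0 then 0
      else a (if t < 0 then nat (t + int n0) else nat (t + int n0 - 1)))" for t
    define n where "n = n0 + N"
    have dpos: "d (radix_pos n0 i) = a i" for i by (auto simp: d_def radix_pos_def)
    have bnd: "0 \<le> d t \<and> d t \<le> \<bar>t\<bar>" for t
    proof (cases "t = 0 \<or> t < - int n0")
      case False
      then have "t = radix_pos n0 (if t < 0 then nat (t + int n0) else nat (t + int n0 - 1))"
        by (auto simp: radix_pos_def)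
      then obtain i where "t = radix_pos n0 i" by blast
      then show ?thesis using a(1)[rule_format, of i] by (simp add: dpos m_def)
    qed (auto simp: d_def)
    have supp: "d t = 0" if "\<bar>t\<bar> > int n" for t
      using that a(2) by (auto simp: d_def n_def)
    have "(\<Sum>i<2*n. of_int (d (radix_pos n i)) * radix_weight (radix_pos n i))
        = (\<Sum>i<2*n0 + N. of_int (d (radix_pos n0 i)) * radix_weight (radix_pos n0 i))"
    proof -
      have "(\<Sum>i<2*n. of_int (d (radix_pos n i)) * radix_weight (radix_pos n i))
         = (\<Sum>i\<in>{N..<2*n}. of_int (d (radix_pos n i)) * radix_weight (radix_pos n i))"
        by (rule sum.mono_neutral_right) (auto simp: radix_pos_def n_def d_def)
      also have "\<dots> = (\<Sum>i<2*n0 + N. of_int (d (radix_pos n0 i)) * radix_weight (radix_pos n0 i))"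
        by (rule sum.reindex_bij_witness[of _ "\<lambda>i. i + N" "\<lambda>i. i - N"])
           (auto simp: n_def radix_pos_def of_nat_diff diff_diff_eq add.commute)
      finally show ?thesis .
    qed
    also have "\<dots> = (\<Sum>i<N. of_int (a i) * radix_weight (radix_pos n0 i))"
      unfolding dpos by (rule sum.mono_neutral_right) (use a in auto)
    also have "\<dots> = q"
    proof -
      have "fact (n0 + 1) * (-1) ^ n0 * (\<Sum>i<N. of_int (a i) * radix_weight (radix_pos n0 i)) = of_int x"
        unfolding sum_distrib_left of_int_sum of_int_mult a(3) m_def
        by (intro sum.cong refl) (simp only: radix_weight_pos[symmetric] mult_ac)
      then have "fact (n0 + 1) * (-1) ^ n0 * (\<Sum>i<N. of_int (a i) * radix_weight (radix_pos n0 i))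
         = fact (n0 + 1) * (-1) ^ n0 * q" using qx by simp
      moreover have "fact (n0 + 1) * (-1) ^ n0 \<noteq> (0::rat)" by simp
      ultimately show ?thesis by (rule mult_left_cancel[THEN iffD1, rotated])
    qed
    finally have "q = (\<Sum>i<2*n. of_int (d (radix_pos n i)) * radix_weight (radix_pos n i))" by simp
    moreover have "finite {t. d t \<noteq> 0}"
      by (rule finite_subset[of _ "{- int n..int n}"]) (use supp in force)+
    ultimately have "is_expansion q d"
      unfolding is_expansion_def using bnd supp by (subst digit_sums[of n d]) blast+
    then show ?thesis by blast
  qed
  moreover have "d = e" if d: "is_expansion q d" and e: "is_expansion q e" for d e
  proof -
    have "finite ({t. d t \<noteq> 0} \<union> {t. e t \<noteq> 0})" using d e by (simp add: is_expansion_def)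
    then obtain n where n: "\<forall>t \<in> {t. d t \<noteq> 0} \<union> {t. e t \<noteq> 0}. nat \<bar>t\<bar> \<le> n"
      using finite_nat_set_iff_bounded_le[of "(\<lambda>t. nat \<bar>t\<bar>) ` ({t. d t \<noteq> 0} \<union> {t. e t \<noteq> 0})"]
      by auto
    have sd: "d t = 0" "e t = 0" if "\<bar>t\<bar> > int n" for t using n that by force+
    let ?m = "\<lambda>j. \<bar>radix_pos n j\<bar> + 1"
    have bd: "0 \<le> d t \<and> d t \<le> \<bar>t\<bar>" "0 \<le> e t \<and> e t \<le> \<bar>t\<bar>" for t
      using d e by (auto simp: is_expansion_def)
    have eq: "(\<Sum>i<2*n. d (radix_pos n i) * (\<Prod>j<i. - ?m j)) = (\<Sum>i<2*n. e (radix_pos n i) * (\<Prod>j<i. - ?m j))"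
    proof -
      have "(of_int (\<Sum>i<2*n. d (radix_pos n i) * (\<Prod>j<i. - ?m j)) :: rat)
          = fact (n + 1) * (-1) ^ n * q"
        using d is_expansion_iff[of n d q] sd(1) by metis
      also have "\<dots> = of_int (\<Sum>i<2*n. e (radix_pos n i) * (\<Prod>j<i. - ?m j))"
        using e is_expansion_iff[of n e q] sd(2) by blast
      finally show ?thesis by (simp only: of_int_eq_iff)
    qed
    have p: "d (radix_pos n i) = e (radix_pos n i)" if "i < 2 * n" for i
      by (rule radix_expansion_unique[of "\<lambda>i. d (radix_pos n i)" ?m "\<lambda>i. e (radix_pos n i)", OF _ _ eq that])
         (use bd in \<open>auto simp: zle_add1_eq_le\<close>)
    show "d = e"
    proof
      fix t
      show "d t = e t"
      proof (cases "t = 0 \<or> \<bar>t\<bar> > int n")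
        case True then show ?thesis using bd[of 0] sd[of t] by auto
      next
        case False
        then have "t = radix_pos n (if t < 0 then nat (t + int n) else nat (t + int n - 1))"
          "(if t < 0 then nat (t + int n) else nat (t + int n - 1)) < 2 * n"
          by (auto simp: radix_pos_def)
        then show ?thesis using p[of "if t < 0 then nat (t + int n) else nat (t + int n - 1)"]
          by (simp only:)
      qed
    qed
  qed
  ultimately show ?thesis by blast
qed

definition digit :: "rat \<Rightarrow> int \<Rightarrow> int" where
  "digit q = (THE d. is_expansion q d)"

definition dom_q :: "rat \<Rightarrow> int set" where
  "dom_q q = {t. t \<noteq> 0 \<and> digit q t \<noteq> 0}"

definition dom_neg :: "rat \<Rightarrow> int set" where
  "dom_neg q = {t \<in> dom_q q. t < 0}"

definition dom_pos :: "rat \<Rightarrow> int set" where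
  "dom_pos q = {t \<in> dom_q q. t > 0}"

definition syndetic :: "'a::ab_semigroup_add set \<Rightarrow> bool" where
  "syndetic E \<longleftrightarrow> (\<exists>F. finite F \<and> F \<noteq> {} \<and> UNIV = (\<Union>g\<in>F. {s. g + s \<in> E}))"

(* dom_neg \<beta> and dom_pos \<gamma> are finite, and nonempty because \<beta> is not an integer and \<gamma> \<noteq> 0,
   so Max and Min are meaningful. *)
definition RVDW :: "real \<Rightarrow> real \<Rightarrow> (rat ^ 'l) set \<Rightarrow> bool" where
  "RVDW k\<^sub>1 k\<^sub>2 B \<longleftrightarrow>
     (\<forall>F k. finite F \<and> F \<noteq> {} \<and> (k::nat) \<ge> 1 \<longrightarrow>
       (\<exists>\<alpha> \<beta> \<gamma>. \<beta> \<notin> \<int> \<and> \<gamma> \<in> \<int> - {0} \<and>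
          dom_pos \<beta> = {} \<and> dom_neg \<gamma> = {} \<and>
          real_of_int (Max (dom_neg \<beta>)) < k\<^sub>1 \<and> k\<^sub>1 < k\<^sub>2 \<and>
          k\<^sub>2 < real_of_int (Min (dom_pos \<gamma>)) \<and>
          (\<forall>p q :: int. 0 \<le> p \<and> p \<le> int k \<and> 0 \<le> q \<and> q \<le> int k \<longrightarrow>
             (\<lambda>f. \<alpha> + (of_int p * \<beta> + of_int q * \<gamma>) *s f) ` F \<subseteq> B)))"

end

(* A syndetic set colours the space with finitely many colours (x gets the first g of the finite
   set with g + x in E), so a monochromatic homothetic copy a + d C of a finite configuration C yields
   a translate of d C inside E. Gallai's theorem provides such a copy with 1 <= d <= N, where N depends
   only on the size of C and the number of colours, not on C itself. Hence C may be chosen after N: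
   take C = {(p b + q c) f} with b = (-1)^T / (T+1)! and c = (-1)^(R+1) R!, where T, R >= N are
   large. As d <= T and d <= R, the number d b has the single digit d at position -T, and d c the
   single digit d at position R. *)
theory Submission
  imports Defs
begin

section \<open>Gallai's theorem with a uniform bound on the dilation factor\<close>

lemma finite_colouring_encode:
  assumes "finite A" "card A \<le> n"
  shows "\<exists>h :: 'b \<Rightarrow> nat. inj_on h A \<and> h ` A \<subseteq> {..<n}"
proof -
  obtain h where "bij_betw h A {0..<card A}"
    using ex_bij_betw_finite_nat[OF assms(1)] by blast
  then show ?thesis
    using assms(2) by (intro exI[of _ h]) (auto simp: bij_betw_def)
qed

locale module_colouring = module scale
  for scale :: "'a::comm_ring_1 \<Rightarrow> 'b::ab_group_add \<Rightarrow> 'b"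
begin

text \<open>The configuration is an indexed family, so repeated points are allowed. Confining the
  copy to \<open>Y\<close> leaves only finitely many colour patterns to distinguish when
  \<open>Y\<close> is finite.\<close>

definition mono_copy :: "nat \<Rightarrow> (nat \<Rightarrow> 'b) \<Rightarrow> ('b \<Rightarrow> nat) \<Rightarrow> nat \<Rightarrow> 'b set \<Rightarrow> bool" where
  "mono_copy m u c N Y \<longleftrightarrow> (\<exists>a d e. 1 \<le> d \<and> d \<le> N \<and>
     (\<forall>i<m. a + scale (of_nat d) (u i) \<in> Y \<and> c (a + scale (of_nat d) (u i)) = e))"

text \<open>Colour focusing: since all \<open>s\<close> copies share the point \<open>f\<close>, either \<open>f\<close> completes one of them or
  it has a colour outside \<open>S\<close>; with \<open>r\<close> colours the latter is impossible for \<open>s = r\<close>.\<close>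

definition colour_fan :: "nat \<Rightarrow> nat \<Rightarrow> (nat \<Rightarrow> 'b) \<Rightarrow> ('b \<Rightarrow> nat) \<Rightarrow> nat \<Rightarrow> 'b set \<Rightarrow> bool" where
  "colour_fan s m u c N Y \<longleftrightarrow> (\<exists>f\<in>Y. \<exists>S. finite S \<and> card S = s \<and> c f \<notin> S \<and> S \<subseteq> range c \<and>
     (\<forall>e\<in>S. \<exists>a d. 1 \<le> d \<and> d \<le> N \<and> a + scale (of_nat d) (u m) = f \<and>
       (\<forall>i<m. a + scale (of_nat d) (u i) \<in> Y \<and> c (a + scale (of_nat d) (u i)) = e)))"

text \<open>The cardinality bound on \<open>Y\<close> is uniform in \<open>u\<close>, which keeps the number of colours of the
  product colourings in the induction independent of \<open>u\<close>.\<close>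

definition gallai_bound :: "nat \<Rightarrow> nat \<Rightarrow> bool" where
  "gallai_bound m r \<longleftrightarrow> (\<exists>N K. \<forall>u. \<exists>Y. finite Y \<and> card Y \<le> K \<and>
     (\<forall>c. (\<forall>x. c x < r) \<longrightarrow> mono_copy m u c N Y))"

definition fan_bound :: "nat \<Rightarrow> nat \<Rightarrow> nat \<Rightarrow> bool" where
  "fan_bound s m r \<longleftrightarrow> (\<exists>N K. \<forall>u. \<exists>Y. finite Y \<and> card Y \<le> K \<and>
     (\<forall>c. (\<forall>x. c x < r) \<longrightarrow> mono_copy (Suc m) u c N Y \<or> colour_fan s m u c N Y))"

section \<open>Colour focusing and the induction on the size of the configuration\<close>

lemma fan_bound_0: "fan_bound 0 m r"
proof -
  have "colour_fan 0 m u c 1 {0}" for u c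
    unfolding colour_fan_def by (intro bexI[of _ 0] exI[of _ "{}"]) auto
  then show ?thesis
    unfolding fan_bound_def by (intro exI[of _ 1] allI exI[of _ "{0}"]) auto
qed

text \<open>The translates of \<open>Y\<close> at the first \<open>m\<close> points of an outer copy
  with factor \<open>d'\<close> look alike. A fan found in one of them therefore recurs in all, and
  taking its parts diagonally across the translates moves every spoke to a common new focus over the
  point of index \<open>m\<close>. The old focus, repeated in the \<open>m\<close> translates,
  supplies one more spoke with a new colour.\<close>

lemma fan_extend:
  fixes u :: "nat \<Rightarrow> 'b"
  assumes fan: "mono_copy (Suc m) u (\<lambda>y. c (a' + scale (of_nat d') (u 0) + y)) N Y \<or>
      colour_fan s m u (\<lambda>y. c (a' + scale (of_nat d') (u 0) + y)) N Y"
    and d': "1 \<le> d'" "d' \<le> N'"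
    and Z: "\<And>i. i \<le> m \<Longrightarrow> a' + scale (of_nat d') (u i) \<in> Z"
    and same: "\<And>i y. i < m \<Longrightarrow> y \<in> Y \<Longrightarrow>
      c (a' + scale (of_nat d') (u i) + y) = c (a' + scale (of_nat d') (u 0) + y)"
    and W: "\<And>z y. z \<in> Z \<Longrightarrow> y \<in> Y \<Longrightarrow> z + y \<in> W"
  shows "mono_copy (Suc m) u c (N + N') W \<or> colour_fan (Suc s) m u c (N + N') W"
  using fan
proof
  let ?b = "a' + scale (of_nat d') (u 0)"
  assume "mono_copy (Suc m) u (\<lambda>y. c (?b + y)) N Y"
  then obtain a d e where 1: "1 \<le> d" "d \<le> N"
    and 2: "\<And>i. i < Suc m \<Longrightarrow> a + scale (of_nat d) (u i) \<in> Y \<and> c (?b + (a + scale (of_nat d) (u i))) = e"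
    unfolding mono_copy_def by blast
  have "mono_copy (Suc m) u c (N + N') W"
    unfolding mono_copy_def
  proof (intro exI conjI allI impI)
    fix i assume i: "i < Suc m"
    have eq: "(?b + a) + scale (of_nat d) (u i) = ?b + (a + scale (of_nat d) (u i))"
      by (simp add: add.assoc)
    show "(?b + a) + scale (of_nat d) (u i) \<in> W"
      unfolding eq using 2[OF i] Z[of 0] W by blast
    show "c ((?b + a) + scale (of_nat d) (u i)) = e"
      unfolding eq using 2[OF i] by blast
  qed (use 1 in auto)
  then show ?thesis ..
next
  let ?b = "a' + scale (of_nat d') (u 0)"
  assume "colour_fan s m u (\<lambda>y. c (?b + y)) N Y"
  then obtain f S where f: "f \<in> Y" and S: "finite S" "card S = s" "c (?b + f) \<notin> S"
      "S \<subseteq> range (\<lambda>y. c (?b + y))"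
    and fan: "\<And>e. e \<in> S \<Longrightarrow> \<exists>a d. 1 \<le> d \<and> d \<le> N \<and> a + scale (of_nat d) (u m) = f \<and>
       (\<forall>i<m. a + scale (of_nat d) (u i) \<in> Y \<and> c (?b + (a + scale (of_nat d) (u i))) = e)"
    unfolding colour_fan_def by blast
  \<comment> \<open>The new focus is the old one moved to the translate at index \<open>m\<close>,
    whose colours are not controlled.\<close>
  define f' where "f' = a' + scale (of_nat d') (u m) + f"
  define S' where "S' = insert (c (?b + f)) S"
  have fW: "f' \<in> W" unfolding f'_def using Z f W by blast
  have S': "finite S'" "card S' = Suc s" "S' \<subseteq> range c"
    using S by (auto simp: S'_def)
  have fan': "\<exists>a d. 1 \<le> d \<and> d \<le> N + N' \<and> a + scale (of_nat d) (u m) = f' \<and>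
       (\<forall>i<m. a + scale (of_nat d) (u i) \<in> W \<and> c (a + scale (of_nat d) (u i)) = e)"
    if "e \<in> S'" for e
  proof (cases "e \<in> S")
    case True
    then obtain a d where ad: "1 \<le> d" "d \<le> N" "a + scale (of_nat d) (u m) = f"
      "\<forall>i<m. a + scale (of_nat d) (u i) \<in> Y \<and> c (?b + (a + scale (of_nat d) (u i))) = e"
      using fan by blast
    \<comment> \<open>Old colours: adding inner and outer copy index by index adds their factors.
      The summand at index \<open>i\<close> lies in the translate of \<open>Y\<close> at the outer
      point \<open>i\<close>, where \<open>same\<close> carries the colour over from the base
      translate.\<close>
    have eq: "(a' + a) + scale (of_nat (d' + d)) (u i)
        = (a' + scale (of_nat d') (u i)) + (a + scale (of_nat d) (u i))" for i
      by (simp add: scale_left_distrib algebra_simps)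
    show ?thesis
    proof (intro exI[of _ "a' + a"] exI[of _ "d' + d"] conjI allI impI)
      show "1 \<le> d' + d" "d' + d \<le> N + N'" using ad d' by auto
      show "(a' + a) + scale (of_nat (d' + d)) (u m) = f'"
        unfolding eq ad(3) f'_def ..
      fix i assume i: "i < m"
      show "(a' + a) + scale (of_nat (d' + d)) (u i) \<in> W"
        unfolding eq using ad(4) i Z[OF less_imp_le[OF i]] W by blast
      show "c ((a' + a) + scale (of_nat (d' + d)) (u i)) = e"
        unfolding eq using ad(4) i same[OF i] by metis
    qed
  next
    case False
    then have e: "e = c (?b + f)" using that by (simp add: S'_def)
    \<comment> \<open>New colour: the spoke consists of the copies of \<open>f\<close> itself, so
      its factor is that of the outer copy alone.\<close>
    have eq: "(a' + f) + scale (of_nat d') (u i) = (a' + scale (of_nat d') (u i)) + f" for i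
      by (simp add: algebra_simps)
    show ?thesis
    proof (intro exI[of _ "a' + f"] exI[of _ d'] conjI allI impI)
      show "1 \<le> d'" "d' \<le> N + N'" using d' by auto
      show "(a' + f) + scale (of_nat d') (u m) = f'"
        unfolding eq f'_def ..
      fix i assume i: "i < m"
      show "(a' + f) + scale (of_nat d') (u i) \<in> W"
        unfolding eq using Z[OF less_imp_le[OF i]] W f by blast
      show "c ((a' + f) + scale (of_nat d') (u i)) = e"
        unfolding eq e using same[OF i f] .
    qed
  qed
  show ?thesis
  proof (cases "c f' \<in> S'")
    case True
    \<comment> \<open>The focus has the colour of some spoke and supplies its missing point of index
      \<open>m\<close>.\<close>
    then obtain a d where ad: "1 \<le> d" "d \<le> N + N'" "a + scale (of_nat d) (u m) = f'"
       "\<forall>i<m. a + scale (of_nat d) (u i) \<in> W \<and> c (a + scale (of_nat d) (u i)) = c f'"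
      using fan' by blast
    then have "mono_copy (Suc m) u c (N + N') W"
      unfolding mono_copy_def using fW
      by (intro exI[of _ a] exI[of _ d] exI[of _ "c f'"]) (auto simp: less_Suc_eq)
    then show ?thesis ..
  next
    case False
    then have "colour_fan (Suc s) m u c (N + N') W"
      unfolding colour_fan_def using fW S' fan' by blast
    then show ?thesis ..
  qed
qed

lemma fan_bound_Suc:
  assumes m: "0 < m" and G: "\<And>r. gallai_bound m r" and B: "fan_bound s m r"
  shows "fan_bound (Suc s) m r"
proof -
  obtain N K where NK: "\<forall>u. \<exists>Y. finite Y \<and> card Y \<le> K \<and>
     (\<forall>c. (\<forall>x. c x < r) \<longrightarrow> mono_copy (Suc m) u c N Y \<or> colour_fan s m u c N Y)"
    using B unfolding fan_bound_def by blast
  \<comment> \<open>\<open>r ^ K\<close> bounds the number of patterns of \<open>r\<close> colours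
    on at most \<open>K\<close> points. It is fixed before \<open>u\<close>, so \<open>N'\<close>
    and \<open>K'\<close> are too.\<close>
  obtain N' K' where NK': "\<forall>u. \<exists>Y. finite Y \<and> card Y \<le> K' \<and>
     (\<forall>c. (\<forall>x. c x < r ^ K) \<longrightarrow> mono_copy m u c N' Y)"
    using G[of "r ^ K"] unfolding gallai_bound_def by blast
  have "\<exists>W. finite W \<and> card W \<le> K' * Suc N' * K \<and> (\<forall>c. (\<forall>x. c x < r) \<longrightarrow>
      mono_copy (Suc m) u c (N + N') W \<or> colour_fan (Suc s) m u c (N + N') W)" for u
  proof -
    obtain Y where Y: "finite Y" "card Y \<le> K" "\<And>c. (\<forall>x. c x < r) \<Longrightarrow>
        mono_copy (Suc m) u c N Y \<or> colour_fan s m u c N Y"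
      using NK by blast
    obtain Y' where Y': "finite Y'" "card Y' \<le> K'"
        "\<And>c. (\<forall>x. c x < r ^ K) \<Longrightarrow> mono_copy m u c N' Y'"
      using NK' by blast
    \<comment> \<open>A copy of the first \<open>m\<close> points inside \<open>Y'\<close> says
      nothing about its point of index \<open>m\<close>. That point is the one of index 0 shifted by
      a multiple of \<open>u m - u 0\<close>, hence the added shifts; the multiple 0 keeps
      \<open>Y'\<close> itself.\<close>
    define Z where "Z = (\<lambda>(z, d). z + scale (of_nat d) (u m - u 0)) ` (Y' \<times> {..N'})"
    define W where "W = (\<lambda>(z, y). z + y) ` (Z \<times> Y)"
    have Z: "finite Z" "card Z \<le> K' * Suc N'"
    proof -
      show "finite Z" unfolding Z_def using Y'(1) by simp
      have "card Z \<le> card (Y' \<times> {..N'})"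
        unfolding Z_def using Y'(1) by (intro card_image_le) simp
      also have "\<dots> \<le> K' * Suc N'"
        unfolding card_cartesian_product using Y'(2) by (intro mult_mono) auto
      finally show "card Z \<le> K' * Suc N'" .
    qed
    have W: "finite W" "card W \<le> K' * Suc N' * K"
    proof -
      show "finite W" unfolding W_def using Z Y(1) by simp
      have "card W \<le> card (Z \<times> Y)"
        unfolding W_def using Z Y(1) by (intro card_image_le) simp
      also have "\<dots> \<le> K' * Suc N' * K"
        unfolding card_cartesian_product using Z Y(2) by (intro mult_mono) auto
      finally show "card W \<le> K' * Suc N' * K" .
    qed
    have "mono_copy (Suc m) u c (N + N') W \<or> colour_fan (Suc s) m u c (N + N') W"
      if c: "\<forall>x. c x < r" for c
    proof -
      have "0 < r" using c by (metis not_less_zero gr0I)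
      define P where "P = Y \<rightarrow>\<^sub>E {..<r}"
      have "finite P" unfolding P_def using Y(1) by (intro finite_PiE) auto
      moreover have "card P \<le> r ^ K"
        unfolding P_def using Y(1,2) \<open>0 < r\<close> by (simp add: card_PiE power_increasing)
      ultimately obtain h where h: "inj_on h P" "h ` P \<subseteq> {..<r ^ K}"
        using finite_colouring_encode by blast
      \<comment> \<open>The product colouring: \<open>x\<close> is coloured by the whole pattern of
        \<open>c\<close> on the translate of \<open>Y\<close> by \<open>x\<close>, which
        \<open>h\<close> encodes as a number.\<close>
      define p where "p x = restrict (\<lambda>y. c (x + y)) Y" for x
      have p: "p x \<in> P" for x unfolding p_def P_def using c by auto
      have "\<forall>x. h (p x) < r ^ K" using h(2) p by blast
      then obtain a' d' e where d': "1 \<le> d'" "d' \<le> N'"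
        and e: "\<And>i. i < m \<Longrightarrow> a' + scale (of_nat d') (u i) \<in> Y' \<and> h (p (a' + scale (of_nat d') (u i))) = e"
        using Y'(3)[of "\<lambda>x. h (p x)"] unfolding mono_copy_def by blast
      have peq: "p (a' + scale (of_nat d') (u i)) = p (a' + scale (of_nat d') (u 0))" if "i < m" for i
        using e[OF that] e[OF m] h(1) p by (metis inj_onD)
      show ?thesis
      proof (rule fan_extend[where a' = a' and d' = d' and Y = Y and Z = Z])
        show "mono_copy (Suc m) u (\<lambda>y. c (a' + scale (of_nat d') (u 0) + y)) N Y \<or>
          colour_fan s m u (\<lambda>y. c (a' + scale (of_nat d') (u 0) + y)) N Y"
          using c by (intro Y(3)) blast
        show "a' + scale (of_nat d') (u i) \<in> Z" if "i \<le> m" for i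
        proof (cases "i = m")
          case True
          have "a' + scale (of_nat d') (u m)
              = (a' + scale (of_nat d') (u 0)) + scale (of_nat d') (u m - u 0)"
            by (simp add: scale_right_diff_distrib)
          then show ?thesis
            unfolding Z_def True using e[OF m] d'
            by (intro image_eqI[of _ _ "(a' + scale (of_nat d') (u 0), d')"]) auto
        next
          case False
          then show ?thesis
            unfolding Z_def using e[of i] that
            by (intro image_eqI[of _ _ "(a' + scale (of_nat d') (u i), 0)"]) auto
        qed
        show "c (a' + scale (of_nat d') (u i) + y) = c (a' + scale (of_nat d') (u 0) + y)"
          if "i < m" "y \<in> Y" for i y
          using fun_cong[OF peq[OF that(1)], of y] that(2) by (simp add: p_def)
        show "z + y \<in> W" if "z \<in> Z" "y \<in> Y" for z y
          unfolding W_def using that by force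
      qed (fact d')+
    qed
    then show ?thesis using W by blast
  qed
  then show ?thesis unfolding fan_bound_def by blast
qed

text \<open>Fans grow one spoke at a time up to \<open>r\<close> spokes. The hypothesis covers every
  number of colours because each growth step applies it to a product colouring.\<close>

lemma gallai_bound_Suc:
  assumes "0 < m" "\<And>r. gallai_bound m r"
  shows "gallai_bound (Suc m) r"
proof -
  have "fan_bound s m r" for s
    by (induction s) (use fan_bound_0 fan_bound_Suc assms in auto)
  then obtain N K where NK: "\<forall>u. \<exists>Y. finite Y \<and> card Y \<le> K \<and>
     (\<forall>c. (\<forall>x. c x < r) \<longrightarrow> mono_copy (Suc m) u c N Y \<or> colour_fan r m u c N Y)"
    unfolding fan_bound_def by blast
  have no_fan: "\<not> colour_fan r m u c N Y" if c: "\<forall>x. c x < r" for u c Y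
  proof
    assume "colour_fan r m u c N Y"
    then obtain f S where S: "finite S" "card S = r" "c f \<notin> S" "S \<subseteq> range c"
      unfolding colour_fan_def by blast
    then have "insert (c f) S \<subseteq> {..<r}" using c by auto
    then have "card (insert (c f) S) \<le> card {..<r}" by (intro card_mono) auto
    then show False using S by simp
  qed
  show ?thesis
    unfolding gallai_bound_def
  proof (rule exI[of _ N], rule exI[of _ K], rule allI)
    fix u
    obtain Y where Y: "finite Y" "card Y \<le> K" and
      *: "\<And>c. \<forall>x. c x < r \<Longrightarrow> mono_copy (Suc m) u c N Y \<or> colour_fan r m u c N Y"
      using NK by blast
    have "mono_copy (Suc m) u c N Y" if "\<forall>x. c x < r" for c
      using *[OF that] no_fan[OF that] by blast
    with Y show "\<exists>Y. finite Y \<and> card Y \<le> K \<and> (\<forall>c. (\<forall>x. c x < r) \<longrightarrow> mono_copy (Suc m) u c N Y)"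
      by blast
  qed
qed

lemma gallai_bound_1: "gallai_bound 1 r"
proof -
  have "mono_copy 1 u c 1 {u 0}" for u c
    unfolding mono_copy_def
    by (rule exI[of _ 0], rule exI[of _ 1], rule exI[of _ "c (u 0)"]) simp
  then show ?thesis
    unfolding gallai_bound_def
    by (metis card.empty card.insert finite.intros empty_iff le_refl)
qed

lemma gallai_bound_pos: "0 < m \<Longrightarrow> gallai_bound m r"
proof (induction m arbitrary: r rule: nat_induct_non_zero)
  case 1
  show ?case by (rule gallai_bound_1)
next
  case (Suc n)
  then show ?case by (intro gallai_bound_Suc)
qed

text \<open>The order of quantifiers is the point: \<open>N\<close> precedes \<open>u\<close>, so a
  configuration may be built from \<open>N\<close>.\<close>

theorem gallai_uniform:
  assumes I: "finite I" "I \<noteq> {}"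
  shows "\<exists>N. \<forall>(u :: 'i \<Rightarrow> 'b) (c :: 'b \<Rightarrow> nat). (\<forall>x. c x < r) \<longrightarrow>
    (\<exists>a d e. 1 \<le> d \<and> d \<le> N \<and> (\<forall>i\<in>I. c (a + scale (of_nat d) (u i)) = e))"
proof -
  obtain h where h: "bij_betw h {0..<card I} I"
    using ex_bij_betw_nat_finite[OF I(1)] by blast
  have "0 < card I" using I by (simp add: card_gt_0_iff)
  then obtain N K where NK: "\<forall>u. \<exists>Y. finite Y \<and> card Y \<le> K \<and>
      (\<forall>c. (\<forall>x. c x < r) \<longrightarrow> mono_copy (card I) u c N Y)"
    using gallai_bound_pos[of "card I" r] unfolding gallai_bound_def by blast
  show ?thesis
  proof (intro exI[of _ N] allI impI)
    fix u :: "'i \<Rightarrow> 'b" and c :: "'b \<Rightarrow> nat"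
    assume "\<forall>x. c x < r"
    then obtain Y where "mono_copy (card I) (u \<circ> h) c N Y" using NK by blast
    then obtain a d e where ade: "1 \<le> d" "d \<le> N"
      "\<And>j. j < card I \<Longrightarrow> c (a + scale (of_nat d) (u (h j))) = e"
      unfolding mono_copy_def o_def by blast
    have "c (a + scale (of_nat d) (u i)) = e" if "i \<in> I" for i
    proof -
      have "i \<in> h ` {0..<card I}"
        using h \<open>i \<in> I\<close> by (simp add: bij_betw_def)
      then obtain j where "j < card I" "i = h j" by auto
      then show ?thesis using ade(3) by simp
    qed
    then show "\<exists>a d e. 1 \<le> d \<and> d \<le> N \<and> (\<forall>i\<in>I. c (a + scale (of_nat d) (u i)) = e)"
      using ade by blast
  qed
qed

end

section \<open>Rationals with a single digit\<close>

lemma digit_eq: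
  assumes "is_expansion q d"
  shows "digit q = d"
  unfolding digit_def using is_expansion_ex1[of q] assms by (metis the1_equality)

text \<open>The bound \<open>d \<le> T\<close> makes \<open>d\<close> an admissible digit at
  position \<open>- int T\<close>, so the number is already written in expanded form and uniqueness
  of expansions applies.\<close>

lemma dom_q_single_neg:
  assumes "1 \<le> d" "d \<le> T"
  shows "dom_q (of_nat d * ((-1) ^ T / fact (T + 1))) = {- int T}"
proof -
  let ?d = "\<lambda>t. if t = - int T then int d else 0"
  have "{t. ?d t \<noteq> 0} = {- int T}" "{s. 1 \<le> s \<and> ?d (- int s) \<noteq> 0} = {T}"
    "{s. 1 \<le> s \<and> ?d (int s) \<noteq> 0} = {}"
    using assms by auto
  then have "is_expansion (of_nat d * ((-1) ^ T / fact (T + 1))) ?d"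
    unfolding is_expansion_def using assms by (simp del: fact_Suc)
  from digit_eq[OF this] show ?thesis
    unfolding dom_q_def using assms by (simp only:) auto
qed

lemma dom_q_single_pos:
  assumes "1 \<le> d" "d \<le> R"
  shows "dom_q (of_nat d * ((-1) ^ (R + 1) * fact R)) = {int R}"
proof -
  let ?d = "\<lambda>t. if t = int R then int d else 0"
  have "{t. ?d t \<noteq> 0} = {int R}" "{s. 1 \<le> s \<and> ?d (- int s) \<noteq> 0} = {}"
    "{s. 1 \<le> s \<and> ?d (int s) \<noteq> 0} = {R}"
    using assms by auto
  then have "is_expansion (of_nat d * ((-1) ^ (R + 1) * fact R)) ?d"
    unfolding is_expansion_def using assms by simp
  from digit_eq[OF this] show ?thesis
    unfolding dom_q_def using assms by (simp only:) auto
qed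

text \<open>The absolute value lies strictly between 0 and 1, since
  \<open>d \<le> T < fact (T + 1)\<close>.\<close>

lemma single_neg_not_Ints:
  assumes "1 \<le> d" "d \<le> T"
  shows "of_nat d * ((-1) ^ T / fact (T + 1)) \<notin> (\<int> :: rat set)"
proof
  let ?q = "of_nat d * ((-1) ^ T / fact (T + 1)) :: rat"
  assume "?q \<in> \<int>"
  moreover have "?q \<noteq> 0" using assms by (simp del: fact_Suc)
  ultimately have "1 \<le> \<bar>?q\<bar>" by (rule Ints_nonzero_abs_ge1)
  moreover have "\<bar>?q\<bar> = of_nat d / fact (T + 1)"
    by (simp add: abs_mult power_abs del: fact_Suc)
  moreover have "(of_nat d :: rat) < fact (T + 1)"
  proof -
    have "d < fact (T + 1)" using assms fact_ge_self[of "T + 1"] by linarith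
    then have "(of_nat d :: rat) < of_nat (fact (T + 1))" by (simp only: of_nat_less_iff)
    then show ?thesis by (simp only: of_nat_fact)
  qed
  ultimately show False by (simp add: divide_simps del: fact_Suc)
qed

section \<open>From colourings to syndetic sets\<close>

theorem corollary3p6:
  fixes E :: "(rat ^ 'l) set" and k\<^sub>1 k\<^sub>2 :: real
  assumes "k\<^sub>1 < k\<^sub>2" and "syndetic E"
  shows "RVDW k\<^sub>1 k\<^sub>2 E"
  unfolding RVDW_def
proof (intro allI impI)
  fix F :: "(rat ^ 'l) set" and k :: nat
  interpret module_colouring "(*s) :: rat \<Rightarrow> rat ^ 'l \<Rightarrow> rat ^ 'l"
    by unfold_locales
  assume F: "finite F \<and> F \<noteq> {} \<and> 1 \<le> k"
  obtain G where G: "finite G" "UNIV = (\<Union>g\<in>G. {s. g + s \<in> E})"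
    using assms(2) unfolding syndetic_def by blast
  obtain h :: "rat ^ 'l \<Rightarrow> nat" where h: "inj_on h G" "h ` G \<subseteq> {..<card G}"
    using finite_colouring_encode[OF G(1)] by blast
  have "\<exists>g. g \<in> G \<and> g + x \<in> E" for x using G(2) by blast
  then obtain g where g: "\<And>x. g x \<in> G" "\<And>x. g x + x \<in> E" by metis
  \<comment> \<open>Indexing by triples fixes the size of the configuration, and hence
    \<open>N\<close>, before \<open>b\<close> and \<open>v\<close> are chosen.\<close>
  define I where "I = {0..int k} \<times> {0..int k} \<times> F"
  have "finite I" "I \<noteq> {}" using F by (auto simp: I_def)
  then obtain N where N: "\<And>(u :: _ \<Rightarrow> rat ^ 'l) c. (\<forall>x. c x < card G) \<Longrightarrow>
      \<exists>a d e. 1 \<le> d \<and> d \<le> N \<and> (\<forall>i\<in>I. c (a + of_nat d *s u i) = e)"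
    using gallai_uniform[of I "card G"] by metis
  \<comment> \<open>The summand \<open>N\<close> leaves room for the digit \<open>d \<le> N\<close>;
    the ceilings push the positions \<open>- T\<close> and \<open>R\<close> beyond
    \<open>k\<^sub>1\<close> and \<open>k\<^sub>2\<close>, and the final 1 makes this
    strict.\<close>
  define T where "T = N + nat \<lceil>\<bar>k\<^sub>1\<bar>\<rceil> + 1"
  define R where "R = N + nat \<lceil>\<bar>k\<^sub>2\<bar>\<rceil> + 1"
  define b :: rat where "b = (-1) ^ T / fact (T + 1)"
  define v :: rat where "v = (-1) ^ (R + 1) * fact R"
  obtain a d e where d: "1 \<le> d" "d \<le> N"
    and e: "\<And>p q f. (p, q, f) \<in> I \<Longrightarrow> h (g (a + of_nat d *s ((of_int p * b + of_int q * v) *s f))) = e"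
  proof -
    have "\<forall>x. h (g x) < card G" using h(2) g(1) by blast
    from N[OF this, of "\<lambda>(p, q, f). (of_int p * b + of_int q * v) *s f"]
    obtain a d e where "1 \<le> d" "d \<le> N" and
      *: "\<forall>i\<in>I. h (g (a + of_nat d *s (case i of (p, q, f) \<Rightarrow> (of_int p * b + of_int q * v) *s f))) = e"
      by blast
    moreover have "h (g (a + of_nat d *s ((of_int p * b + of_int q * v) *s f))) = e"
      if "(p, q, f) \<in> I" for p q f
      using bspec[OF * that] by simp
    ultimately show thesis using that by blast
  qed
  \<comment> \<open>Any point of the copy shows that the common colour \<open>e\<close> is the code
    of some \<open>g0\<close> in \<open>G\<close>; this is the shift that carries the copy into
    \<open>E\<close>.\<close>
  obtain f0 where "f0 \<in> F" using F by blast
  then have "(0, 0, f0) \<in> I" by (simp add: I_def)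
  then obtain g0 where g0: "g0 \<in> G" "h g0 = e" using e g(1) by blast
  have dT: "d \<le> T" and dR: "d \<le> R" using d by (auto simp: T_def R_def)
  have dom\<beta>: "dom_q (of_nat d * b) = {- int T}" and dom\<gamma>: "dom_q (of_nat d * v) = {int R}"
    unfolding b_def v_def using d(1) dT dR by (intro dom_q_single_neg dom_q_single_pos; simp)+
  have T: "0 < T" "- real T < k\<^sub>1" and R: "0 < R" "k\<^sub>2 < real R"
    unfolding T_def R_def by linarith+
  have neg: "dom_neg (of_nat d * b) = {- int T}" "dom_neg (of_nat d * v) = {}"
    and pos: "dom_pos (of_nat d * b) = {}" "dom_pos (of_nat d * v) = {int R}"
    unfolding dom_neg_def dom_pos_def dom\<beta> dom\<gamma> using T(1) R(1) by auto
  have in_E: "(g0 + a) + (of_int p * (of_nat d * b) + of_int q * (of_nat d * v)) *s f \<in> E"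
    if "0 \<le> p" "p \<le> int k" "0 \<le> q" "q \<le> int k" "f \<in> F" for p q f
  proof -
    define x where "x = a + of_nat d *s ((of_int p * b + of_int q * v) *s f)"
    have "(p, q, f) \<in> I" using that by (simp add: I_def)
    then have "h (g x) = h g0" using e g0(2) unfolding x_def by simp
    \<comment> \<open>Equal codes mean equal shifts, so a single \<open>g0\<close> serves all points
      and is absorbed into \<alpha>.\<close>
    then have "g x = g0" using h(1) g(1) g0(1) by (metis inj_onD)
    then have "g0 + x \<in> E" using g(2) by metis
    moreover have "g0 + x = (g0 + a) + (of_int p * (of_nat d * b) + of_int q * (of_nat d * v)) *s f"
      unfolding x_def by (simp add: vec_eq_iff algebra_simps)
    ultimately show ?thesis by simp
  qed
  show "\<exists>\<alpha> \<beta> \<gamma>. \<beta> \<notin> \<int> \<and> \<gamma> \<in> \<int> - {0} \<and> dom_pos \<beta> = {} \<and> dom_neg \<gamma> = {} \<and>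
      real_of_int (Max (dom_neg \<beta>)) < k\<^sub>1 \<and> k\<^sub>1 < k\<^sub>2 \<and> k\<^sub>2 < real_of_int (Min (dom_pos \<gamma>)) \<and>
      (\<forall>p q. 0 \<le> p \<and> p \<le> int k \<and> 0 \<le> q \<and> q \<le> int k \<longrightarrow>
         (\<lambda>f. \<alpha> + (of_int p * \<beta> + of_int q * \<gamma>) *s f) ` F \<subseteq> E)"
  proof (rule exI[of _ "g0 + a"], rule exI[of _ "of_nat d * b"], rule exI[of _ "of_nat d * v"], intro conjI)
    show "of_nat d * b \<notin> \<int>"
      unfolding b_def using d(1) dT by (rule single_neg_not_Ints)
    show "of_nat d * v \<in> \<int> - {0}"
      using d(1) by (auto simp: v_def intro!: Ints_mult Ints_power fact_in_Ints)
    show "\<forall>p q. 0 \<le> p \<and> p \<le> int k \<and> 0 \<le> q \<and> q \<le> int k \<longrightarrow>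
        (\<lambda>f. (g0 + a) + (of_int p * (of_nat d * b) + of_int q * (of_nat d * v)) *s f) ` F \<subseteq> E"
      using in_E by blast
  qed (use neg pos T(2) R(2) assms(1) in simp_all)
qed

end
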